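(* Let $\zeta_5=e^{2\pi i/5}$ and write $c_k=\theta[\tfrac15;\tfrac k5]$, $d_k=\theta[\tfrac35;\tfrac k5]$ for $k\in\{1,3,5,7,9\}$ (theta constants, functions of $\tau$). For every $\tau\in\mathbb{H}^2$: $$(c_1^2c_3-\zeta_5^4c_9^2c_7)(\zeta_5d_7^2d_1-\zeta_5d_3^2d_9)=(d_1^2d_3-\zeta_5^2d_9^2d_7)(\zeta_5^2c_7^2c_1-\zeta_5^2c_3^2c_9),$$ $$(\zeta_5^2c_5^2c_7+c_3^2c_1)(d_1^2d_5+\zeta_5d_7^2d_3)=(\zeta_5d_5^2d_7+d_3^2d_1)(c_1^2c_5+\zeta_5^2c_7^2c_3),$$ $$(\zeta_5^2c_7^2c_5-\zeta_5^2c_9^2c_1)(d_1^2d_7+\zeta_5d_5^2d_9)=(\zeta_5d_7^2d_5-\zeta_5d_9^2d_1)(c_1^2c_7+\zeta_5^2c_5^2c_9),$$ $$(-c_1^2c_9+c_3^2c_5)(\zeta_5d_9^2d_3+d_5^2d_1)=(-d_1^2d_9+d_3^2d_5)(\zeta_5^2c_9^2c_3+c_5^2c_1),$$ $$(\zeta_5^2c_7^2c_9+c_5^2c_3)(d_3^2d_7+\zeta_5d_9^2d_5)=(\zeta_5d_7^2d_9+d_5^2d_3)(c_3^2c_7+\zeta_5^2c_9^2c_5).$$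
   Context: Let $\mathbb{H}^2=\{\tau\in\mathbb{C}:\Im\tau>0\}$. For $(\epsilon,\epsilon')\in\mathbb{R}^2$, $$\theta[\epsilon;\epsilon'](\zeta,\tau)=\sum_{n\in\mathbb{Z}}\exp\Big(2\pi i\Big[\tfrac12\big(n+\tfrac{\epsilon}{2}\big)^2\tau+\big(n+\tfrac{\epsilon}{2}\big)\big(\zeta+\tfrac{\epsilon'}{2}\big)\Big]\Big),$$ and $\theta[\epsilon;\epsilon']=\theta[\epsilon;\epsilon'](0,\tau)$ denotes the theta constant. *)

theory Defs
  imports "HOL-Analysis.Analysis"
begin

text \<open>Theta function with real characteristic [eps; eps'], as a sum over all integers n
  (absolutely convergent for Im tau > 0).\<close>
definition theta_char :: "real \<Rightarrow> real \<Rightarrow> complex \<Rightarrow> complex \<Rightarrow> complex" where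
  "theta_char e e' z t = (\<Sum>\<^sub>\<infinity>n::int.
     exp (2 * pi * \<i> * ((1/2) * (of_int n + of_real e / 2)^2 * t
                         + (of_int n + of_real e / 2) * (z + of_real e' / 2))))"

definition theta_const :: "real \<Rightarrow> real \<Rightarrow> complex \<Rightarrow> complex" where
  "theta_const e e' t = theta_char e e' 0 t"

definition zeta5 :: complex where
  "zeta5 = exp (2 * pi * \<i> / 5)"

end

theory Submission
  imports Defs
begin

text \<open>The constants \<open>c k\<close> and \<open>d k\<close> are, up to explicit exponential factors, the values of
  the odd theta function \<open>\<theta> w = theta_char 1 1 w \<tau>\<close> (\<open>odd_theta\<close> below) at \<open>w = \<delta> * \<tau> + (k - 5) / 10\<close>
  with \<open>\<delta> = -2/5\<close> and \<open>\<delta> = -1/5\<close> respectively. For fixed \<open>a\<close>, the function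
  \<open>G w a = \<theta> (w + a)^2 * \<theta> (w - 2 * a) - \<theta> (w - a)^2 * \<theta> (w + 2 * a)\<close> is an even theta
  function of order three with the multipliers of \<open>\<theta>^3\<close>. Such functions form a
  one-dimensional space, so \<open>G w a\<close> splits as a function of \<open>a\<close> times a function of \<open>w\<close>,
  and therefore \<open>G w a * G w' b = G w b * G w' a\<close>. The five identities are the cases
  \<open>a = 1/5\<close>, \<open>b = 2/5\<close> with \<open>w\<close> and \<open>w'\<close> shifted by the five multiples of \<open>1/5\<close>.\<close>

section \<open>Absolutely convergent products of series\<close>

lemma abs_summable_on_prod:
  fixes f :: "'a \<Rightarrow> 'c::{real_normed_div_algebra,banach}" and g :: "'b \<Rightarrow> 'c"
  assumes "(\<lambda>x. norm (f x)) summable_on A" "(\<lambda>y. norm (g y)) summable_on B"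
  shows "(\<lambda>p. norm (case p of (x, y) \<Rightarrow> f x * g y)) summable_on (A \<times> B)"
proof -
  have "(\<lambda>x. norm (f x) * (\<Sum>\<^sub>\<infinity>y\<in>B. norm (g y))) summable_on A"
    by (intro summable_on_cmult_left assms)
  then show ?thesis
    unfolding Infinite_Sum.abs_summable_on_Sigma_iff using assms(2)
    by (auto simp: norm_mult infsum_cmult_right' infsum_nonneg intro!: summable_on_cmult_right)
qed

lemma infsum_mult_prod:
  fixes f :: "'a \<Rightarrow> 'c::{real_normed_div_algebra,banach}" and g :: "'b \<Rightarrow> 'c"
  assumes "(\<lambda>x. norm (f x)) summable_on A" "(\<lambda>y. norm (g y)) summable_on B"
  shows "infsum f A * infsum g B = (\<Sum>\<^sub>\<infinity>(x, y)\<in>A \<times> B. f x * g y)"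
proof -
  have "(\<lambda>(x, y). f x * g y) summable_on (A \<times> B)"
    using abs_summable_on_prod[OF assms] by (rule abs_summable_summable)
  from infsum_Sigma'_banach[OF this] show ?thesis
    by (simp add: infsum_cmult_left' infsum_cmult_right')
qed

lemma summable_on_exp_minus_abs_int:
  "(\<lambda>n::int. exp (- \<bar>real_of_int n\<bar>)) summable_on UNIV"
proof -
  have nat: "(\<lambda>n::nat. exp (- real n)) summable_on UNIV"
  proof (rule norm_summable_imp_summable_on)
    have "summable (\<lambda>n. exp (-1 :: real) ^ n)"
      by (intro summable_geometric) auto
    then show "summable (\<lambda>n. norm (exp (- real n)))"
      by (simp add: exp_of_nat_mult[symmetric])
  qed
  have UNIV_eq: "(UNIV :: int set) = range int \<union> range (\<lambda>n. - int n)"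
    by (auto simp: image_iff) (metis int_cases2)
  have "(\<lambda>n::int. exp (- \<bar>real_of_int n\<bar>)) summable_on range int"
    using nat by (subst summable_on_reindex) (auto simp: o_def)
  moreover have "(\<lambda>n::int. exp (- \<bar>real_of_int n\<bar>)) summable_on range (\<lambda>n. - int n)"
    using nat by (subst summable_on_reindex) (auto simp: o_def inj_on_def)
  ultimately show ?thesis
    unfolding UNIV_eq by (rule summable_on_union)
qed

section \<open>The odd theta function: convergence, translation by 1, relation to theta
  constants\<close>

definition odd_theta_term :: "complex \<Rightarrow> complex \<Rightarrow> int \<Rightarrow> complex" where
  "odd_theta_term \<tau> w n =
     exp (2 * pi * \<i> * ((1/2) * (of_int n + 1/2)^2 * \<tau> + (of_int n + 1/2) * (w + 1/2)))"

definition odd_theta :: "complex \<Rightarrow> complex \<Rightarrow> complex" where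
  "odd_theta \<tau> w = (\<Sum>\<^sub>\<infinity>n. odd_theta_term \<tau> w n)"

lemma norm_odd_theta_term:
  "norm (odd_theta_term \<tau> w n) =
     exp (- pi * Im \<tau> * (of_int n + 1/2)^2 - 2 * pi * Im w * (of_int n + 1/2))"
proof -
  have "of_int n + 1/2 = complex_of_real (of_int n + 1/2)"
    by simp
  then have "odd_theta_term \<tau> w n = exp (2 * pi * \<i> * ((1/2) * of_real ((of_int n + 1/2)^2) * \<tau>
      + of_real (of_int n + 1/2) * (w + 1/2)))"
    unfolding odd_theta_term_def by (simp only: of_real_power)
  then show ?thesis
    by (simp add: norm_exp_eq_Re algebra_simps del: of_real_add of_real_power)
qed

lemma odd_theta_term_abs_summable:
  assumes "Im \<tau> > 0"
  shows "(\<lambda>n. norm (odd_theta_term \<tau> w n)) summable_on UNIV"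
proof (rule Infinite_Sum.abs_summable_on_comparison_test')
  \<comment> \<open>The extra 1 in \<open>\<beta>\<close> leaves a spare \<open>- s\<close> in the
    exponent, which gives the decay in \<open>n\<close>. The rest,
    \<open>- \<alpha> * s\<^sup>2 + \<beta> * s\<close>, is bounded by completing the
    square.\<close>
  define \<alpha> \<beta> where "\<alpha> = pi * Im \<tau>" and "\<beta> = \<bar>2 * pi * Im w\<bar> + 1"
  have "\<alpha> > 0"
    using assms by (simp add: \<alpha>_def)
  show "(\<lambda>n::int. exp (\<beta>\<^sup>2 / (4 * \<alpha>) + 1/2) * exp (- \<bar>real_of_int n\<bar>)) summable_on UNIV"
    by (intro summable_on_cmult_right summable_on_exp_minus_abs_int)
  fix n :: int
  define s where "s = \<bar>real_of_int n + 1/2\<bar>"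
  have "- (2 * pi * Im w * (of_int n + 1/2)) \<le> \<bar>2 * pi * Im w * (of_int n + 1/2)\<bar>"
    by linarith
  also have "\<dots> = (\<beta> - 1) * s"
    by (simp add: \<beta>_def s_def abs_mult)
  finally have "- \<alpha> * s\<^sup>2 - 2 * pi * Im w * (of_int n + 1/2) \<le> - \<alpha> * s\<^sup>2 + (\<beta> - 1) * s"
    by simp
  moreover have "- \<alpha> * s\<^sup>2 + \<beta> * s \<le> \<beta>\<^sup>2 / (4 * \<alpha>)"
  proof -
    have "0 \<le> (2 * \<alpha> * s - \<beta>)\<^sup>2 / (4 * \<alpha>)"
      using \<open>\<alpha> > 0\<close> by simp
    also have "\<dots> = \<alpha> * s\<^sup>2 - \<beta> * s + \<beta>\<^sup>2 / (4 * \<alpha>)"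
      using \<open>\<alpha> > 0\<close> by (simp add: field_simps power2_eq_square)
    finally show ?thesis
      by simp
  qed
  moreover have "\<bar>real_of_int n\<bar> \<le> s + 1/2"
    unfolding s_def by linarith
  ultimately have "- \<alpha> * s\<^sup>2 - 2 * pi * Im w * (of_int n + 1/2) \<le>
      \<beta>\<^sup>2 / (4 * \<alpha>) + 1/2 + - \<bar>real_of_int n\<bar>"
    by (simp add: algebra_simps)
  then show "norm (odd_theta_term \<tau> w n) \<le>
      exp (\<beta>\<^sup>2 / (4 * \<alpha>) + 1/2) * exp (- \<bar>real_of_int n\<bar>)"
    by (simp add: norm_odd_theta_term exp_add[symmetric] \<alpha>_def s_def del: exp_add)
qed

lemma odd_theta_plus1: "odd_theta \<tau> (w + 1) = - odd_theta \<tau> w"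
proof -
  have "odd_theta_term \<tau> (w + 1) n = - odd_theta_term \<tau> w n" for n
  proof -
    have "odd_theta_term \<tau> (w + 1) n = odd_theta_term \<tau> w n * exp (2 * of_int n * pi * \<i> + pi * \<i>)"
      unfolding odd_theta_term_def exp_add[symmetric] by (rule arg_cong[where f = exp]) (simp add: algebra_simps)
    also have "exp (2 * of_int n * pi * \<i> + pi * \<i>) = -1"
      using exp_integer_2pi[of "of_int n"] by (simp add: exp_add)
    finally show ?thesis
      by simp
  qed
  then show ?thesis
    by (simp add: odd_theta_def infsum_uminus)
qed

text \<open>Expanding the square in \<open>n + 1/2 + \<delta>\<close> turns the cross term into a
  shift of the argument by \<open>\<delta> * \<tau>\<close>; the terms free of \<open>n\<close> form
  the prefactor. The \<open>- 1\<close> cancels the characteristic 1 built into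
  \<open>odd_theta\<close>.\<close>

lemma theta_const_eq_odd_theta:
  fixes \<delta> :: real and \<tau> :: complex
  assumes "e = 2 * \<delta> + 1"
  shows "theta_const e e' \<tau> =
    exp (pi * \<i> * \<delta>^2 * \<tau> + pi * \<i> * \<delta> * e') * odd_theta \<tau> (\<delta> * \<tau> + (of_real e' - 1) / 2)"
proof -
  have "exp (2 * pi * \<i> * ((1/2) * (of_int n + of_real e / 2)^2 * \<tau>
         + (of_int n + of_real e / 2) * (0 + of_real e' / 2)))
     = exp (pi * \<i> * \<delta>^2 * \<tau> + pi * \<i> * \<delta> * e') * odd_theta_term \<tau> (\<delta> * \<tau> + (of_real e' - 1) / 2) n" for n
    unfolding odd_theta_term_def exp_add[symmetric] assms
    by (rule arg_cong[where f = exp]) (simp add: field_simps power2_eq_square)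
  then show ?thesis
    unfolding theta_const_def theta_char_def odd_theta_def
    by (simp add: infsum_cmult_right')
qed

section \<open>Expansion of a product of three theta values in theta functions of order
  three\<close>

definition cubic_coeff :: "complex \<Rightarrow> complex \<Rightarrow> int \<Rightarrow> complex" where
  "cubic_coeff \<tau> a r = (\<Sum>\<^sub>\<infinity>(x, y).
     exp (2 * pi * \<i> * ((1/2) * \<tau> * ((of_int x + 1/2)^2 + (of_int y + 1/2)^2
                                       + (of_int (r - x - y) + 1/2)^2)
                         + a * of_int (x + y - 2 * (r - x - y)))))"

text \<open>Up to a factor free of \<open>w\<close>, a theta series with modulus
  \<open>3 * \<tau>\<close> and argument \<open>3 * w\<close> plus a constant. That factor is
  absorbed by the sum of squares in \<open>cubic_coeff\<close>.\<close>

definition cubic_theta :: "complex \<Rightarrow> complex \<Rightarrow> int \<Rightarrow> complex" where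
  "cubic_theta \<tau> w r = (\<Sum>\<^sub>\<infinity>m::int.
     exp (2 * pi * \<i> * ((1/2) * \<tau> * (2 * of_int m * (of_int r + 3/2) + 3 * of_int m^2)
                         + (3 * of_int m + of_int r + 3/2) * (w + 1/2))))"

text \<open>Reflecting all three indices by \<open>n \<mapsto> -1 - n\<close> preserves each
  \<open>(n + 1/2)^2\<close> and negates the coefficient of \<open>a\<close>.\<close>

lemma cubic_coeff_minus: "cubic_coeff \<tau> (- a) r = cubic_coeff \<tau> a (- 3 - r)"
  unfolding cubic_coeff_def
  by (rule infsum_reindex_bij_witness[where i = "\<lambda>(x, y). (- 1 - x, - 1 - y)"
        and j = "\<lambda>(x, y). (- 1 - x, - 1 - y)"])
    (auto simp: algebra_simps power2_eq_square)

text \<open>Raising all three indices by 1 changes the sum of squares by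
  \<open>2 * (-3 + 3/2) + 3 = 0\<close> and keeps the coefficient of \<open>a\<close>.\<close>

lemma cubic_coeff_minus3: "cubic_coeff \<tau> a (- 3) = cubic_coeff \<tau> a 0"
  unfolding cubic_coeff_def
  by (rule infsum_reindex_bij_witness[where i = "\<lambda>(x, y). (x - 1, y - 1)"
        and j = "\<lambda>(x, y). (x + 1, y + 1)"])
    (auto simp: algebra_simps power2_eq_square)

text \<open>The residue of \<open>n1 + n2 + n3\<close> modulo 3 is represented by \<open>{-2, -1, 0}\<close> because the
  reflection \<open>n \<mapsto> -1 - n\<close> sends a sum \<open>r\<close> to \<open>-3 - r\<close>.\<close>

lemma odd_theta_cubic_expansion:
  assumes "Im \<tau> > 0"
  shows "odd_theta \<tau> (w + a)^2 * odd_theta \<tau> (w - 2 * a) =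
    (\<Sum>r\<in>{-2, -1, 0}. cubic_theta \<tau> w r * cubic_coeff \<tau> a r)"
proof -
  define E where "E = (\<lambda>(x, y, v). odd_theta_term \<tau> (w + a) x * (odd_theta_term \<tau> (w + a) y
      * odd_theta_term \<tau> (w - 2 * a) v))"
  define q where "q = (\<lambda>r m::int.
     exp (2 * pi * \<i> * ((1/2) * \<tau> * (2 * of_int m * (of_int r + 3/2) + 3 * of_int m^2)
                         + (3 * of_int m + of_int r + 3/2) * (w + 1/2))))"
  define p where "p = (\<lambda>r (x, y).
     exp (2 * pi * \<i> * ((1/2) * \<tau> * ((of_int x + 1/2)^2 + (of_int y + 1/2)^2
                                       + (of_int (r - x - y) + 1/2)^2)
                         + a * of_int (x + y - 2 * (r - x - y)))))"
  define I where "I = {-2, -1, 0 :: int} \<times> (UNIV :: int set) \<times> (UNIV :: (int \<times> int) set)"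
  note sums = odd_theta_term_abs_summable[OF assms]
  have E_pair: "(\<lambda>p. norm (case p of (y, v) \<Rightarrow>
      odd_theta_term \<tau> (w + a) y * odd_theta_term \<tau> (w - 2 * a) v)) summable_on UNIV"
    using abs_summable_on_prod[OF sums sums, of "w + a" "w - 2 * a"] by simp
  have "odd_theta \<tau> (w + a)^2 * odd_theta \<tau> (w - 2 * a) =
      odd_theta \<tau> (w + a) * (odd_theta \<tau> (w + a) * odd_theta \<tau> (w - 2 * a))"
    by (simp add: power2_eq_square)
  also have "\<dots> = infsum E UNIV"
    unfolding odd_theta_def infsum_mult_prod[OF sums sums]
    using infsum_mult_prod[OF sums E_pair] by (simp add: E_def case_prod_unfold)
  finally have E_eq: "odd_theta \<tau> (w + a)^2 * odd_theta \<tau> (w - 2 * a) = infsum E UNIV" .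
  have "E summable_on UNIV"
    using abs_summable_summable[OF abs_summable_on_prod[OF sums E_pair, of "w + a"]]
    by (simp add: E_def case_prod_unfold)
  then have "(E has_sum infsum E UNIV) UNIV"
    by simp
  \<comment> \<open>Each triple has sum \<open>r + 3 * m\<close>; subtracting \<open>m\<close> from
    every entry separates the exponent, since the half-shifted entries then sum to
    \<open>r + 3/2\<close>. The \<open>+ 2\<close> before \<open>div 3\<close> puts \<open>r\<close>
    in \<open>{-2, -1, 0}\<close>.\<close>
  also have "?this \<longleftrightarrow> ((\<lambda>(r, m, z). q r m * p r z) has_sum infsum E UNIV) I"
  proof (rule has_sum_reindex_bij_witness[where
        j = "\<lambda>(x, y, v). let m = (x + y + v + 2) div 3
             in (x + y + v - 3 * m, m, x - m, y - m)"
        and i = "\<lambda>(r, m, x, y). (x + m, y + m, r - x - y + m)"])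
    fix n :: "int \<times> int \<times> int"
    obtain x y v where n: "n = (x, y, v)"
      by (cases n)
    define m where "m = (x + y + v + 2) div 3"
    show "(case case n of (x, y, v) \<Rightarrow> let m = (x + y + v + 2) div 3
             in (x + y + v - 3 * m, m, x - m, y - m) of (r, m, z) \<Rightarrow> q r m * p r z) = E n"
      unfolding n E_def q_def p_def odd_theta_term_def Let_def m_def[symmetric] prod.case
        exp_add[symmetric]
      by (rule arg_cong[where f = exp]) (simp add: field_simps power2_eq_square)
  qed (auto simp: I_def Let_def)
  finally have has_sum: "((\<lambda>(r, m, z). q r m * p r z) has_sum infsum E UNIV) I" .
  then have summable: "(\<lambda>(r, m, z). q r m * p r z) summable_on I"
    by (rule has_sum_imp_summable)
  have "(\<lambda>(m, z). q r m * p r z) summable_on UNIV" if "r \<in> {-2, -1, 0}" for r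
    using summable_on_SigmaD1[OF summable[unfolded I_def] that] by simp
  then have slice: "(\<Sum>\<^sub>\<infinity>(m, z). q r m * p r z) = (\<Sum>\<^sub>\<infinity>m. \<Sum>\<^sub>\<infinity>z. q r m * p r z)"
    if "r \<in> {-2, -1, 0}" for r
    using infsum_Sigma'_banach[of "\<lambda>m z. q r m * p r z" UNIV "\<lambda>_. UNIV"] that by simp
  have "infsum E UNIV = (\<Sum>\<^sub>\<infinity>(r, m, z)\<in>I. q r m * p r z)"
    using has_sum by (rule infsumI[symmetric])
  also have "\<dots> = (\<Sum>\<^sub>\<infinity>r\<in>{-2, -1, 0}. \<Sum>\<^sub>\<infinity>(m, z). q r m * p r z)"
    using summable unfolding I_def by (simp only: infsum_Sigma'_banach UNIV_Times_UNIV)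
  also have "\<dots> = (\<Sum>r\<in>{-2, -1, 0}. \<Sum>\<^sub>\<infinity>m. \<Sum>\<^sub>\<infinity>z. q r m * p r z)"
    using slice by simp
  also have "\<dots> = (\<Sum>r\<in>{-2, -1, 0}. infsum (q r) UNIV * infsum (p r) UNIV)"
    by (simp add: infsum_cmult_left' infsum_cmult_right')
  finally show ?thesis
    unfolding E_eq by (simp add: cubic_theta_def cubic_coeff_def q_def p_def)
qed

section \<open>Rank-one factorisation and the exchange identity\<close>

definition cubic_diff :: "complex \<Rightarrow> complex \<Rightarrow> complex \<Rightarrow> complex" where
  "cubic_diff \<tau> w a = odd_theta \<tau> (w + a)^2 * odd_theta \<tau> (w - 2 * a)
     - odd_theta \<tau> (w - a)^2 * odd_theta \<tau> (w + 2 * a)"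

text \<open>The sign change of \<open>a\<close> fixes the coefficient for \<open>r = 0\<close> and
  swaps those for -1 and -2. So the first class cancels and the other two enter antisymmetrically,
  leaving a single product.\<close>

lemma cubic_diff_factor:
  assumes "Im \<tau> > 0"
  shows "cubic_diff \<tau> w a = (cubic_coeff \<tau> a (- 1) - cubic_coeff \<tau> a (- 2))
    * (cubic_theta \<tau> w (- 1) - cubic_theta \<tau> w (- 2))"
  using odd_theta_cubic_expansion[OF assms, of w a]
    odd_theta_cubic_expansion[OF assms, of w "- a"]
  by (simp add: cubic_diff_def cubic_coeff_minus cubic_coeff_minus3 algebra_simps)

lemma cubic_diff_exchange:
  assumes "Im \<tau> > 0"
  shows "cubic_diff \<tau> w a * cubic_diff \<tau> w' b = cubic_diff \<tau> w b * cubic_diff \<tau> w' a"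
  by (simp add: cubic_diff_factor[OF assms])

theorem theorem8p1:
  fixes \<tau> :: complex
  assumes "Im \<tau> > 0"
  defines "c \<equiv> \<lambda>k::nat. theta_const (1/5) (real k / 5) \<tau>"
      and "d \<equiv> \<lambda>k::nat. theta_const (3/5) (real k / 5) \<tau>"
      and "z \<equiv> zeta5"
  shows
   "(c 1^2 * c 3 - z^4 * c 9^2 * c 7) * (z * d 7^2 * d 1 - z * d 3^2 * d 9)
      = (d 1^2 * d 3 - z^2 * d 9^2 * d 7) * (z^2 * c 7^2 * c 1 - z^2 * c 3^2 * c 9)
   \<and> (z^2 * c 5^2 * c 7 + c 3^2 * c 1) * (d 1^2 * d 5 + z * d 7^2 * d 3)
      = (z * d 5^2 * d 7 + d 3^2 * d 1) * (c 1^2 * c 5 + z^2 * c 7^2 * c 3)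
   \<and> (z^2 * c 7^2 * c 5 - z^2 * c 9^2 * c 1) * (d 1^2 * d 7 + z * d 5^2 * d 9)
      = (z * d 7^2 * d 5 - z * d 9^2 * d 1) * (c 1^2 * c 7 + z^2 * c 5^2 * c 9)
   \<and> (- (c 1^2 * c 9) + c 3^2 * c 5) * (z * d 9^2 * d 3 + d 5^2 * d 1)
      = (- (d 1^2 * d 9) + d 3^2 * d 5) * (z^2 * c 9^2 * c 3 + c 5^2 * c 1)
   \<and> (z^2 * c 7^2 * c 9 + c 5^2 * c 3) * (d 3^2 * d 7 + z * d 9^2 * d 5)
      = (z * d 7^2 * d 9 + d 5^2 * d 3) * (c 3^2 * c 7 + z^2 * c 9^2 * c 5)
    "
proof -
  define \<rho> where "\<rho> = exp (2 * pi * \<i> / 25)"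
  define S where "S = (\<lambda>(\<delta>::real) (j::int). odd_theta \<tau> (\<delta> * \<tau> + j / 5))"
  \<comment> \<open>\<open>K\<close> absorbs the phase at \<open>k = 9\<close>, so the remaining
    powers of \<open>\<rho>\<close> have natural exponents: \<open>9 - k\<close> for
    \<open>c\<close> and \<open>(9 - k) / 2\<close> for \<open>d\<close>.\<close>
  define K where "K = (\<lambda>\<delta>::real. exp (pi * \<i> * \<delta>^2 * \<tau> + 9 / 5 * pi * \<i> * \<delta>))"
  have z: "z = \<rho>^5"
    by (simp add: z_def zeta5_def \<rho>_def exp_of_nat_mult[symmetric] mult_ac)
  have theta: "theta_const e (real k / 5) \<tau> = K \<delta> * \<rho>^n * S \<delta> j"
    if "e = 2 * \<delta> + 1" "int k = 2 * j + 5" "real n = - 5 * \<delta> * real_of_int (2 - j)"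
    for e k \<delta> n j
  proof -
    have k: "complex_of_nat k = 2 * of_int j + 5"
      using arg_cong[OF that(2), of complex_of_int] by simp
    have n: "complex_of_nat n = of_real (- 5 * \<delta> * real_of_int (2 - j))"
      using that(3) by (metis of_real_of_nat_eq)
    have \<rho>: "\<rho>^n = exp (of_real (- 5 * \<delta> * real_of_int (2 - j)) * (2 * pi * \<i> / 25))"
      unfolding \<rho>_def exp_of_nat_mult[symmetric] n ..
    have exp: "exp (pi * \<i> * \<delta>^2 * \<tau> + pi * \<i> * \<delta> * (real k / 5)) = K \<delta> * \<rho>^n"
      unfolding \<rho> K_def exp_add[symmetric]
      by (rule arg_cong[where f = exp]) (simp add: k field_simps)
    have arg: "(complex_of_nat k / 5 - 1) / 2 = of_int j / 5"
      by (simp add: k field_simps)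
    show ?thesis
      using theta_const_eq_odd_theta[OF that(1), of "real k / 5" \<tau>] exp by (simp add: S_def arg)
  qed
  define C D where "C = S (- 2/5)" and "D = S (- 1/5)"
  define M L where "M = K (- 2/5)" and "L = K (- 1/5)"
  have c: "c 1 = M * \<rho>^8 * C (- 2)" "c 3 = M * \<rho>^6 * C (- 1)" "c 5 = M * \<rho>^4 * C 0"
    "c 7 = M * \<rho>^2 * C 1" "c 9 = M * \<rho>^0 * C 2"
    unfolding c_def C_def M_def by (rule theta; simp)+
  have d: "d 1 = L * \<rho>^4 * D (- 2)" "d 3 = L * \<rho>^3 * D (- 1)" "d 5 = L * \<rho>^2 * D 0"
    "d 7 = L * \<rho>^1 * D 1" "d 9 = L * \<rho>^0 * D 2"
    unfolding d_def D_def L_def by (rule theta; simp)+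
  have S_wrap: "S \<delta> (j + 5) = - S \<delta> j" for \<delta> j
    using odd_theta_plus1[of \<tau> "\<delta> * \<tau> + j / 5"] by (simp add: S_def add_divide_distrib add.assoc)
  \<comment> \<open>The arguments \<open>s \<plusminus> 1\<close>, \<open>s \<plusminus> 2\<close>,
    \<open>s \<plusminus> 4\<close> with \<open>s\<close> in -2..2 stay in -6..6, and
    antiperiodicity brings them back to -2..2.\<close>
  have C_wrap: "C 3 = - C (- 2)" "C 4 = - C (- 1)" "C 5 = - C 0" "C 6 = - C 1"
    "C (- 3) = - C 2" "C (- 4) = - C 1" "C (- 5) = - C 0" "C (- 6) = - C (- 1)"
    and D_wrap: "D 3 = - D (- 2)" "D 4 = - D (- 1)" "D 5 = - D 0" "D 6 = - D 1"
    "D (- 3) = - D 2" "D (- 4) = - D 1" "D (- 5) = - D 0" "D (- 6) = - D (- 1)"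
    unfolding C_def D_def
    using S_wrap[of _ "-2"] S_wrap[of _ "-1"] S_wrap[of _ 0] S_wrap[of _ 1]
      S_wrap[of _ "-3"] S_wrap[of _ "-4"] S_wrap[of _ "-5"] S_wrap[of _ "-6"]
    by simp_all
  define G where "G = (\<lambda>(A :: int \<Rightarrow> complex) s a. A (s + a)^2 * A (s - 2 * a) - A (s - a)^2 * A (s + 2 * a))"
  have G: "G (S \<delta>) s a = cubic_diff \<tau> (\<delta> * \<tau> + s / 5) (a / 5)" for \<delta> and s a :: int
    by (simp add: G_def S_def cubic_diff_def algebra_simps add_divide_distrib diff_divide_distrib)
  have exchange: "G C s 1 * G D s 2 = G C s 2 * G D s 1" for s :: int
    unfolding C_def D_def G by (rule cubic_diff_exchange[OF assms(1)])
  show ?thesis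
    \<comment> \<open>In the order of the conjunction the identities come from \<open>s\<close> = 0,
      2, -1, 1, -2. The powers of \<open>z = \<rho>^5\<close> make both terms of each bracket carry
      the same power of \<open>\<rho>\<close>, which then factors out with \<open>M^3\<close> or
      \<open>L^3\<close>.\<close>
    using exchange[of 0] exchange[of 1] exchange[of 2] exchange[of "-1"] exchange[of "-2"]
    unfolding c d z G_def
    by (simp add: C_wrap D_wrap) algebra
qed

end
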